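(* Let $n$ be a positive integer and let $\Gamma\cup\{\phi\}\subseteq\mathsf{Form}$ be a set of formulas. Then $\Gamma\vdash_{\mathbf{K}_n}\phi$ if and only if $\phi$ is true in every $n+1$-valued Kripke model of $\Gamma$.
   Context: Formulas: let $\mathsf{Prop}$ be an infinite set of propositional variables. $\mathsf{Form}$ is the smallest set containing $\mathsf{Prop}$ and containing $\neg\phi$, $\phi\oplus\psi$, $\square\phi$ whenever it contains $\phi,\psi$. Abbreviations: $\phi\to\psi$ is $\psi\oplus\neg\phi$; $\psi\odot\phi$ is $\neg(\neg\psi\oplus\neg\phi)$; $\phi\leftrightarrow\psi$ is $(\phi\to\psi)\odot(\psi\to\phi)$; $\phi^m$ is $\phi\odot\cdots\odot\phi$ ($m$ factors). $\text{Ł}_n=\{0,\frac1n,\ldots,\frac{n-1}{n},1\}\subseteq[0,1]$. A many-valued Kripke model $\mathcal{M}=\langle W,R,\mathrm{Val}\rangle$ consists of a non-empty set $W$, a relation $R\subseteq W\times W$ and a map $\mathrm{Val}:\mathsf{Prop}\times W\to[0,1]$, extended to formulas by $\mathrm{Val}(\phi\oplus\psi,w)=\min(\mathrm{Val}(\phi,w)+\mathrm{Val}(\psi,w),1)$, $\mathrm{Val}(\neg\phi,w)=1-\mathrm{Val}(\phi,w)$, $\mathrm{Val}(\square\phi,w)=\inf\{\mathrm{Val}(\phi,w')\mid(w,w')\in R\}$ (infimum in $[0,1]$, so the infimum of the empty set is $1$). It is an $n+1$-valued Kripke model if $\mathrm{Val}(p,w)\in\text{Ł}_n$ for all $p\in\mathsf{Prop}$,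 $w\in W$. A formula $\phi$ is true in $\mathcal{M}$ if $\mathrm{Val}(\phi,w)=1$ for every $w\in W$. $\mathcal{M}$ is a model of $\Gamma$ if every formula of $\Gamma$ is true in $\mathcal{M}$. A modal many-valued logic is a set $\mathbf{L}\subseteq\mathsf{Form}$ closed under modus ponens, uniform substitution, and the necessitation rule (from $\phi$ infer $\square\phi$), and containing: (i) $p\to(q\to p)$, $(p\to q)\to((q\to r)\to(p\to r))$, $((p\to q)\to q)\to((q\to p)\to p)$, $(\neg p\to\neg q)\to(q\to p)$ (an axiomatic base of infinite-valued Łukasiewicz logic); (ii) $\square(p\to q)\to(\square p\to\square q)$; (iii) $\square(p\oplus p)\leftrightarrow\square p\oplus\square p$ and $\square(p\odot p)\leftrightarrow\square p\odot\square p$; (iv) $\square(p\oplus p^m)\leftrightarrow(\square p\oplus(\square p)^m)$ for every positive integer $m$. $\mathbf{K}_n$ is the smallest modal many-valued logic that also contains an axiomatic base of the $n+1$-valued Łukasiewicz logic (the logic of the $\square$-free formulas that take the value $1$ under every assignment of values of $\text{Ł}_n$ to the variables). Deducibility: $\Gamma\vdash_{\mathbf{L}}\phi$ means that $\phi$ belongs to every extension of $\Gamma\cup\mathbf{L}$ that is closed under substitution and modus ponens.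
   Formalization: In deducibility, "closed under substitution" is taken as replacement of provable equivalents (with modus ponens, the same as closure under necessitation); with uniform substitution the claim fails, since {p} would prove q although a model of {p} can make q false. *)

theory Defs
  imports Complex_Main
begin

datatype 'p form = Var 'p | Neg "'p form" | Oplus "'p form" "'p form" (infixl "\<oplus>" 65) | Box "'p form"

abbreviation Imp :: "'p form \<Rightarrow> 'p form \<Rightarrow> 'p form" (infixr "\<^bold>\<rightarrow>" 55)
  where "\<phi> \<^bold>\<rightarrow> \<psi> \<equiv> \<psi> \<oplus> Neg \<phi>"

abbreviation Odot :: "'p form \<Rightarrow> 'p form \<Rightarrow> 'p form" (infixr "\<odot>" 70)
  where "\<psi> \<odot> \<phi> \<equiv> Neg (Neg \<psi> \<oplus> Neg \<phi>)"

abbreviation Iff :: "'p form \<Rightarrow> 'p form \<Rightarrow> 'p form" (infix "\<^bold>\<leftrightarrow>" 53)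
  where "\<phi> \<^bold>\<leftrightarrow> \<psi> \<equiv> (\<phi> \<^bold>\<rightarrow> \<psi>) \<odot> (\<psi> \<^bold>\<rightarrow> \<phi>)"

(* m factors, for m >= 1; the value at m = 0 is irrelevant *)
definition fpow :: "'p form \<Rightarrow> nat \<Rightarrow> 'p form"
  where "fpow \<phi> m = ((\<lambda>\<psi>. \<phi> \<odot> \<psi>) ^^ (m - 1)) \<phi>"

primrec subst :: "('p \<Rightarrow> 'p form) \<Rightarrow> 'p form \<Rightarrow> 'p form" where
  "subst \<sigma> (Var p) = \<sigma> p"
| "subst \<sigma> (Neg \<phi>) = Neg (subst \<sigma> \<phi>)"
| "subst \<sigma> (\<phi> \<oplus> \<psi>) = subst \<sigma> \<phi> \<oplus> subst \<sigma> \<psi>"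
| "subst \<sigma> (Box \<phi>) = Box (subst \<sigma> \<phi>)"

primrec box_free :: "'p form \<Rightarrow> bool" where
  "box_free (Var p) \<longleftrightarrow> True"
| "box_free (Neg \<phi>) \<longleftrightarrow> box_free \<phi>"
| "box_free (\<phi> \<oplus> \<psi>) \<longleftrightarrow> box_free \<phi> \<and> box_free \<psi>"
| "box_free (Box \<phi>) \<longleftrightarrow> False"

definition Luk :: "nat \<Rightarrow> real set"
  where "Luk n = {real i / real n | i. i \<le> n}"

(* only used on box-free formulas; the last clause is a dummy *)
primrec eval :: "('p \<Rightarrow> real) \<Rightarrow> 'p form \<Rightarrow> real" where
  "eval v (Var p) = v p"
| "eval v (Neg \<phi>) = 1 - eval v \<phi>"
| "eval v (\<phi> \<oplus> \<psi>) = min (eval v \<phi> + eval v \<psi>) 1"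
| "eval v (Box \<phi>) = 0"

definition luk_logic :: "nat \<Rightarrow> 'p form set"
  where "luk_logic n =
    {\<phi>. box_free \<phi> \<and> (\<forall>v. (\<forall>p. v p \<in> Luk n) \<longrightarrow> eval v \<phi> = 1)}"

inductive_set luk_closure :: "'p form set \<Rightarrow> 'p form set" for B where
  base: "\<phi> \<in> B \<Longrightarrow> \<phi> \<in> luk_closure B"
| mp: "\<phi> \<in> luk_closure B \<Longrightarrow> \<phi> \<^bold>\<rightarrow> \<psi> \<in> luk_closure B \<Longrightarrow> \<psi> \<in> luk_closure B"
| subst: "\<phi> \<in> luk_closure B \<Longrightarrow> (\<And>p. box_free (\<sigma> p)) \<Longrightarrow> subst \<sigma> \<phi> \<in> luk_closure B"

definition axiomatic_base :: "nat \<Rightarrow> 'p form set \<Rightarrow> bool"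
  where "axiomatic_base n B \<longleftrightarrow> luk_closure B = luk_logic n"

definition closed_mp :: "'p form set \<Rightarrow> bool"
  where "closed_mp L \<longleftrightarrow> (\<forall>\<phi> \<psi>. \<phi> \<in> L \<longrightarrow> \<phi> \<^bold>\<rightarrow> \<psi> \<in> L \<longrightarrow> \<psi> \<in> L)"

definition closed_uniform_subst :: "'p form set \<Rightarrow> bool"
  where "closed_uniform_subst L \<longleftrightarrow> (\<forall>\<phi> \<sigma>. \<phi> \<in> L \<longrightarrow> subst \<sigma> \<phi> \<in> L)"

definition closed_nec :: "'p form set \<Rightarrow> bool"
  where "closed_nec L \<longleftrightarrow> (\<forall>\<phi>. \<phi> \<in> L \<longrightarrow> Box \<phi> \<in> L)"

definition modal_mv_logic :: "'p form set \<Rightarrow> bool"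
  where "modal_mv_logic L \<longleftrightarrow>
    closed_mp L \<and> closed_uniform_subst L \<and> closed_nec L \<and>
    (\<forall>p q r.
      Var p \<^bold>\<rightarrow> (Var q \<^bold>\<rightarrow> Var p) \<in> L \<and>
      (Var p \<^bold>\<rightarrow> Var q) \<^bold>\<rightarrow> ((Var q \<^bold>\<rightarrow> Var r) \<^bold>\<rightarrow> (Var p \<^bold>\<rightarrow> Var r)) \<in> L \<and>
      ((Var p \<^bold>\<rightarrow> Var q) \<^bold>\<rightarrow> Var q) \<^bold>\<rightarrow> ((Var q \<^bold>\<rightarrow> Var p) \<^bold>\<rightarrow> Var p) \<in> L \<and>
      (Neg (Var p) \<^bold>\<rightarrow> Neg (Var q)) \<^bold>\<rightarrow> (Var q \<^bold>\<rightarrow> Var p) \<in> L \<and>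
      Box (Var p \<^bold>\<rightarrow> Var q) \<^bold>\<rightarrow> (Box (Var p) \<^bold>\<rightarrow> Box (Var q)) \<in> L \<and>
      Box (Var p \<oplus> Var p) \<^bold>\<leftrightarrow> (Box (Var p) \<oplus> Box (Var p)) \<in> L \<and>
      Box (Var p \<odot> Var p) \<^bold>\<leftrightarrow> (Box (Var p) \<odot> Box (Var p)) \<in> L \<and>
      (\<forall>m\<ge>1. Box (Var p \<oplus> fpow (Var p) m) \<^bold>\<leftrightarrow> (Box (Var p) \<oplus> fpow (Box (Var p)) m) \<in> L))"

(* The logic K_n, where B is an axiomatic base of the (n+1)-valued Lukasiewicz logic;
   by K_logic_eq below it does not depend on the choice of B. *)
definition K_logic :: "'p form set \<Rightarrow> 'p form set"
  where "K_logic B = \<Inter> {L. modal_mv_logic L \<and> B \<subseteq> L}"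

(* Substitution of equivalents. In the definition of deducibility from a set Gamma of
   hypotheses, "substitution" has to be this rule. It cannot be uniform substitution:
   then {p} would prove q for any two variables, whereas p can be true in a model in which
   q is not; and it must entail necessitation (cf. deducible_iff_necessitation), since a
   formula that is true in a model has its box true there as well. *)
definition closed_replacement :: "'p form set \<Rightarrow> bool"
  where "closed_replacement T \<longleftrightarrow>
    (\<forall>\<phi> \<psi> \<chi> p. \<phi> \<^bold>\<leftrightarrow> \<psi> \<in> T \<longrightarrow>
      subst (Var(p := \<phi>)) \<chi> \<in> T \<longrightarrow> subst (Var(p := \<psi>)) \<chi> \<in> T)"

definition deducible :: "'p form set \<Rightarrow> 'p form set \<Rightarrow> 'p form \<Rightarrow> bool"
  where "deducible L \<Gamma> \<phi> \<longleftrightarrow>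
    (\<forall>T. \<Gamma> \<union> L \<subseteq> T \<longrightarrow> closed_replacement T \<longrightarrow> closed_mp T \<longrightarrow> \<phi> \<in> T)"

record ('p, 'w) kripke =
  worlds :: "'w set"
  rel :: "('w \<times> 'w) set"
  val :: "'p \<Rightarrow> 'w \<Rightarrow> real"

definition kripke_model :: "('p, 'w) kripke \<Rightarrow> bool"
  where "kripke_model M \<longleftrightarrow> worlds M \<noteq> {} \<and> rel M \<subseteq> worlds M \<times> worlds M \<and>
    (\<forall>p. \<forall>w \<in> worlds M. 0 \<le> val M p w \<and> val M p w \<le> 1)"

(* Adding 1 to the set makes this the infimum taken in [0,1], with Inf {} = 1. *)
primrec Val :: "('p, 'w) kripke \<Rightarrow> 'p form \<Rightarrow> 'w \<Rightarrow> real" where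
  "Val M (Var p) w = val M p w"
| "Val M (Neg \<phi>) w = 1 - Val M \<phi> w"
| "Val M (\<phi> \<oplus> \<psi>) w = min (Val M \<phi> w + Val M \<psi> w) 1"
| "Val M (Box \<phi>) w = Inf (insert 1 {Val M \<phi> w' | w'. (w, w') \<in> rel M})"

definition valued_model :: "nat \<Rightarrow> ('p, 'w) kripke \<Rightarrow> bool"
  where "valued_model n M \<longleftrightarrow> kripke_model M \<and> (\<forall>p. \<forall>w \<in> worlds M. val M p w \<in> Luk n)"

definition true_in :: "('p, 'w) kripke \<Rightarrow> 'p form \<Rightarrow> bool"
  where "true_in M \<phi> \<longleftrightarrow> (\<forall>w \<in> worlds M. Val M \<phi> w = 1)"

definition model_of :: "('p, 'w) kripke \<Rightarrow> 'p form set \<Rightarrow> bool"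
  where "model_of M \<Gamma> \<longleftrightarrow> (\<forall>\<psi> \<in> \<Gamma>. true_in M \<psi>)"

lemma Luk_unit: "x \<in> Luk n \<Longrightarrow> 0 \<le> x \<and> x \<le> 1"
  by (auto simp: Luk_def divide_le_eq_1)

lemma Luk_Neg: "n \<ge> 1 \<Longrightarrow> x \<in> Luk n \<Longrightarrow> 1 - x \<in> Luk n"
  unfolding Luk_def
  apply clarify
  subgoal for i by (rule exI[of _ "n - i"]) (auto simp: field_simps of_nat_diff)
  done

lemma Luk_Oplus: "n \<ge> 1 \<Longrightarrow> x \<in> Luk n \<Longrightarrow> y \<in> Luk n \<Longrightarrow> min (x + y) 1 \<in> Luk n"
  unfolding Luk_def
  apply clarify
  subgoal for i j by (rule exI[of _ "min (i + j) n"]) (auto simp: field_simps min_def)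
  done

lemma eval_Luk:
  assumes "n \<ge> 1" "\<And>p. v p \<in> Luk n" "box_free \<phi>"
  shows "eval v \<phi> \<in> Luk n"
  using assms(3) by (induction \<phi>) (use assms(1,2) Luk_Neg Luk_Oplus in auto)

lemma eval_subst:
  "box_free \<phi> \<Longrightarrow> eval v (subst \<sigma> \<phi>) = eval (\<lambda>p. eval v (\<sigma> p)) \<phi>"
  by (induction \<phi>) auto

lemma box_free_subst: "box_free \<phi> \<Longrightarrow> (\<And>p. box_free (\<sigma> p)) \<Longrightarrow> box_free (subst \<sigma> \<phi>)"
  by (induction \<phi>) auto

lemma axiomatic_base_luk_logic:
  assumes "n \<ge> 1"
  shows "axiomatic_base n (luk_logic n)"
proof -
  have "\<phi> \<in> luk_logic n" if "\<phi> \<in> luk_closure (luk_logic n)" for \<phi> :: "'a form"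
    using that
  proof induction
    case (mp \<phi> \<psi>)
    have "eval v \<psi> = 1" if "\<forall>p. v p \<in> Luk n" for v
    proof -
      have "eval v \<psi> \<in> Luk n" using mp that assms by (intro eval_Luk) (auto simp: luk_logic_def)
      then have "eval v \<psi> \<le> 1" by (auto dest: Luk_unit)
      moreover have "eval v \<phi> = 1" "eval v (\<phi> \<^bold>\<rightarrow> \<psi>) = 1"
        using mp that by (auto simp: luk_logic_def simp del: eval.simps)
      ultimately show ?thesis by simp
    qed
    then show ?case using mp by (auto simp: luk_logic_def)
  next
    case (subst \<phi> \<sigma>)
    have "eval v (subst \<sigma> \<phi>) = 1" if "\<forall>p. v p \<in> Luk n" for v
    proof -
      have "\<forall>p. eval v (\<sigma> p) \<in> Luk n" using assms that subst by (blast intro: eval_Luk)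
      then show ?thesis using subst by (simp add: luk_logic_def eval_subst)
    qed
    then show ?case using subst by (simp add: luk_logic_def box_free_subst)
  qed auto
  then show ?thesis
    unfolding axiomatic_base_def by (auto intro: luk_closure.base)
qed

lemma luk_closure_subset:
  assumes "modal_mv_logic L" "B \<subseteq> L"
  shows "luk_closure B \<subseteq> L"
proof
  fix \<phi> assume "\<phi> \<in> luk_closure B"
  then show "\<phi> \<in> L"
  proof induction
    case (mp \<phi> \<psi>)
    then show ?case using assms(1) unfolding modal_mv_logic_def closed_mp_def by blast
  next
    case (subst \<phi> \<sigma>)
    then show ?case using assms(1) unfolding modal_mv_logic_def closed_uniform_subst_def by blast
  qed (use assms(2) in blast)
qed

lemma K_logic_eq:
  assumes "axiomatic_base n B"
  shows "K_logic B = K_logic (luk_logic n)"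
proof -
  have "B \<subseteq> luk_logic n" using assms by (auto simp: axiomatic_base_def intro: luk_closure.base)
  moreover have "luk_logic n \<subseteq> L" if "modal_mv_logic L" "B \<subseteq> L" for L
    using luk_closure_subset[OF that] assms by (simp add: axiomatic_base_def)
  ultimately have "modal_mv_logic L \<and> B \<subseteq> L \<longleftrightarrow> modal_mv_logic L \<and> luk_logic n \<subseteq> L" for L by blast
  then show ?thesis by (simp add: K_logic_def)
qed

lemma modal_mv_logic_K: "modal_mv_logic (K_logic B)"
proof -
  have "closed_mp (K_logic B)"
    unfolding closed_mp_def K_logic_def modal_mv_logic_def by (blast dest: closed_mp_def[THEN iffD1])
  moreover have "closed_uniform_subst (K_logic B)"
    unfolding closed_uniform_subst_def K_logic_def modal_mv_logic_def
    by (blast dest: closed_uniform_subst_def[THEN iffD1])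
  moreover have "closed_nec (K_logic B)"
    unfolding closed_nec_def K_logic_def modal_mv_logic_def
    by (blast dest: closed_nec_def[THEN iffD1])
  ultimately show ?thesis
    unfolding modal_mv_logic_def by (simp add: K_logic_def) (simp add: modal_mv_logic_def)
qed

lemma luk_logic_subset_K: "axiomatic_base n B \<Longrightarrow> luk_logic n \<subseteq> K_logic B"
  by (subst K_logic_eq, assumption) (auto simp: K_logic_def)

lemma K_taut:
  assumes "axiomatic_base n B" "box_free \<phi>"
    and "\<And>v. (\<And>p. 0 \<le> v p \<and> v p \<le> 1) \<Longrightarrow> eval v \<phi> = 1"
  shows "subst \<sigma> \<phi> \<in> K_logic B"
proof -
  have "\<phi> \<in> luk_logic n"
    unfolding luk_logic_def using assms(2,3) by (blast dest: Luk_unit)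
  then show ?thesis
    using luk_logic_subset_K[OF assms(1)] modal_mv_logic_K[of B]
    unfolding modal_mv_logic_def closed_uniform_subst_def by blast
qed

lemma K_tauts:
  fixes a b c d :: "'p form"
  assumes "infinite (UNIV :: 'p set)" "axiomatic_base n B"
  shows "a \<^bold>\<rightarrow> a \<in> K_logic B"
    and "a \<^bold>\<leftrightarrow> a \<in> K_logic B"
    and "a \<^bold>\<rightarrow> ((a \<^bold>\<rightarrow> a) \<^bold>\<leftrightarrow> a) \<in> K_logic B"
    and "(a \<^bold>\<leftrightarrow> b) \<^bold>\<rightarrow> (a \<^bold>\<rightarrow> b) \<in> K_logic B"
    and "(a \<^bold>\<leftrightarrow> b) \<^bold>\<rightarrow> (b \<^bold>\<rightarrow> a) \<in> K_logic B"
    and "a \<^bold>\<rightarrow> (b \<^bold>\<rightarrow> (a \<odot> b)) \<in> K_logic B"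
    and "(a \<^bold>\<leftrightarrow> b) \<^bold>\<rightarrow> (Neg a \<^bold>\<leftrightarrow> Neg b) \<in> K_logic B"
    and "(a \<^bold>\<leftrightarrow> b) \<^bold>\<rightarrow> ((c \<^bold>\<leftrightarrow> d) \<^bold>\<rightarrow> ((a \<oplus> c) \<^bold>\<leftrightarrow> (b \<oplus> d))) \<in> K_logic B"
proof -
  obtain P :: "'p set" where "finite P" "card P = 4"
    using infinite_arbitrarily_large[OF assms(1)] by blast
  then obtain p q r s :: 'p where ne: "distinct [p, q, r, s]"
    by (auto simp: card_Suc_eq numeral_eq_Suc)
  define \<sigma> where "\<sigma> = Var(p := a, q := b, r := c, s := d)"
  have \<sigma>: "\<sigma> p = a" "\<sigma> q = b" "\<sigma> r = c" "\<sigma> s = d"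
    using ne by (auto simp: \<sigma>_def)
  note t = K_taut[OF assms(2), where \<sigma> = \<sigma>]
  show "a \<^bold>\<rightarrow> a \<in> K_logic B"
    using t[of "Var p \<^bold>\<rightarrow> Var p"] by (simp add: \<sigma>)
  show "a \<^bold>\<leftrightarrow> a \<in> K_logic B"
    using t[of "Var p \<^bold>\<leftrightarrow> Var p"] by (simp add: \<sigma>)
  show "a \<^bold>\<rightarrow> ((a \<^bold>\<rightarrow> a) \<^bold>\<leftrightarrow> a) \<in> K_logic B"
    using t[of "Var p \<^bold>\<rightarrow> ((Var p \<^bold>\<rightarrow> Var p) \<^bold>\<leftrightarrow> Var p)"] by (simp add: \<sigma>)
  have "eval v ((Var p \<^bold>\<leftrightarrow> Var q) \<^bold>\<rightarrow> (Var p \<^bold>\<rightarrow> Var q)) = 1"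
    if v: "\<And>p. 0 \<le> v p \<and> v p \<le> 1" for v
    using v[of p] v[of q] by (auto simp: min_def)
  then show "(a \<^bold>\<leftrightarrow> b) \<^bold>\<rightarrow> (a \<^bold>\<rightarrow> b) \<in> K_logic B"
    using t[of "(Var p \<^bold>\<leftrightarrow> Var q) \<^bold>\<rightarrow> (Var p \<^bold>\<rightarrow> Var q)"]
    by (simp only: subst.simps box_free.simps \<sigma> simp_thms)
  have "eval v ((Var p \<^bold>\<leftrightarrow> Var q) \<^bold>\<rightarrow> (Var q \<^bold>\<rightarrow> Var p)) = 1"
    if v: "\<And>p. 0 \<le> v p \<and> v p \<le> 1" for v
    using v[of p] v[of q] by (auto simp: min_def)
  then show "(a \<^bold>\<leftrightarrow> b) \<^bold>\<rightarrow> (b \<^bold>\<rightarrow> a) \<in> K_logic B"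
    using t[of "(Var p \<^bold>\<leftrightarrow> Var q) \<^bold>\<rightarrow> (Var q \<^bold>\<rightarrow> Var p)"]
    by (simp only: subst.simps box_free.simps \<sigma> simp_thms)
  have "eval v (Var p \<^bold>\<rightarrow> (Var q \<^bold>\<rightarrow> (Var p \<odot> Var q))) = 1"
    if v: "\<And>p. 0 \<le> v p \<and> v p \<le> 1" for v
    using v[of p] v[of q] by (auto simp: min_def)
  then show "a \<^bold>\<rightarrow> (b \<^bold>\<rightarrow> (a \<odot> b)) \<in> K_logic B"
    using t[of "Var p \<^bold>\<rightarrow> (Var q \<^bold>\<rightarrow> (Var p \<odot> Var q))"]
    by (simp only: subst.simps box_free.simps \<sigma> simp_thms)
  have "eval v ((Var p \<^bold>\<leftrightarrow> Var q) \<^bold>\<rightarrow> (Neg (Var p) \<^bold>\<leftrightarrow> Neg (Var q))) = 1"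
    if v: "\<And>p. 0 \<le> v p \<and> v p \<le> 1" for v
    using v[of p] v[of q] by (auto simp: min_def)
  then show "(a \<^bold>\<leftrightarrow> b) \<^bold>\<rightarrow> (Neg a \<^bold>\<leftrightarrow> Neg b) \<in> K_logic B"
    using t[of "(Var p \<^bold>\<leftrightarrow> Var q) \<^bold>\<rightarrow> (Neg (Var p) \<^bold>\<leftrightarrow> Neg (Var q))"]
    by (simp only: subst.simps box_free.simps \<sigma> simp_thms)
  let ?f = "(Var p \<^bold>\<leftrightarrow> Var q) \<^bold>\<rightarrow> ((Var r \<^bold>\<leftrightarrow> Var s) \<^bold>\<rightarrow> ((Var p \<oplus> Var r) \<^bold>\<leftrightarrow> (Var q \<oplus> Var s)))"
  have "eval v ?f = 1" if v: "\<And>p. 0 \<le> v p \<and> v p \<le> 1" for v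
  proof -
    have iff: "eval v (\<phi> \<^bold>\<leftrightarrow> \<psi>) = 1 - \<bar>eval v \<phi> - eval v \<psi>\<bar>"
      if "0 \<le> eval v \<phi> \<and> eval v \<phi> \<le> 1" "0 \<le> eval v \<psi> \<and> eval v \<psi> \<le> 1" for \<phi> \<psi>
      using that by (auto simp: min_def abs_if)
    have imp: "eval v (\<phi> \<^bold>\<rightarrow> \<psi>) = 1" if "eval v \<phi> \<le> eval v \<psi>" for \<phi> \<psi>
      using that by (simp add: min_def)
    have imp': "eval v (\<phi> \<^bold>\<rightarrow> \<psi>) = min (eval v \<psi> + (1 - eval v \<phi>)) 1" for \<phi> \<psi>
      by simp
    have d: "\<bar>min (v p + v r) 1 - min (v q + v s) 1\<bar> \<le> \<bar>v p - v q\<bar> + \<bar>v r - v s\<bar>"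
      by (auto simp: min_def abs_if)
    have e1: "eval v (Var p \<^bold>\<leftrightarrow> Var q) = 1 - \<bar>v p - v q\<bar>"
      using iff[of "Var p" "Var q"] v[of p] v[of q] by (simp only: eval.simps(1))
    have e2: "eval v (Var r \<^bold>\<leftrightarrow> Var s) = 1 - \<bar>v r - v s\<bar>"
      using iff[of "Var r" "Var s"] v[of r] v[of s] by (simp only: eval.simps(1))
    have e3: "eval v ((Var p \<oplus> Var r) \<^bold>\<leftrightarrow> (Var q \<oplus> Var s))
        = 1 - \<bar>min (v p + v r) 1 - min (v q + v s) 1\<bar>"
      by (subst iff) (use v[of p] v[of q] v[of r] v[of s] in simp_all)
    show ?thesis
      by (rule imp, unfold imp' e1 e2 e3) (use d in simp)
  qed
  then show "(a \<^bold>\<leftrightarrow> b) \<^bold>\<rightarrow> ((c \<^bold>\<leftrightarrow> d) \<^bold>\<rightarrow> ((a \<oplus> c) \<^bold>\<leftrightarrow> (b \<oplus> d))) \<in> K_logic B"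
    using t[of ?f] by (simp only: subst.simps box_free.simps \<sigma> simp_thms)
qed

lemma closed_replacement_iff_closed_nec:
  fixes T :: "'p form set"
  assumes inf: "infinite (UNIV :: 'p set)" and B: "axiomatic_base n B"
    and KT: "K_logic B \<subseteq> T" and "closed_mp T"
  shows "closed_replacement T \<longleftrightarrow> closed_nec T"
proof -
  note tauts = K_tauts[OF inf B, THEN subsetD[OF KT]]
  have mp: "\<psi> \<in> T" if "\<phi> \<^bold>\<rightarrow> \<psi> \<in> T" "\<phi> \<in> T" for \<phi> \<psi>
    using that \<open>closed_mp T\<close> unfolding closed_mp_def by blast
  note K = modal_mv_logic_K[of B, unfolded modal_mv_logic_def]
  show ?thesis
  proof
    assume R: "closed_replacement T"
    show "closed_nec T"
      unfolding closed_nec_def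
    proof safe
      fix \<phi> assume "\<phi> \<in> T"
      then have eq: "(\<phi> \<^bold>\<rightarrow> \<phi>) \<^bold>\<leftrightarrow> \<phi> \<in> T" by (rule mp[OF tauts(3)])
      have "Box (\<phi> \<^bold>\<rightarrow> \<phi>) \<in> K_logic B"
        using K K_tauts(1)[OF inf B, of \<phi>] unfolding closed_nec_def by blast
      then have bx: "Box (\<phi> \<^bold>\<rightarrow> \<phi>) \<in> T" using KT by blast
      have "subst (Var(p := \<phi> \<^bold>\<rightarrow> \<phi>)) (Box (Var p)) \<in> T" for p using bx by simp
      then have "subst (Var(p := \<phi>)) (Box (Var p)) \<in> T" for p
        using R eq unfolding closed_replacement_def by blast
      then show "Box \<phi> \<in> T" by simp
    qed
  next
    assume N: "closed_nec T"
    obtain p q :: 'p where "p \<noteq> q"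
      using ex_new_if_finite[OF inf, of "{undefined}"] by auto
    have ax: "Box (\<phi> \<^bold>\<rightarrow> \<psi>) \<^bold>\<rightarrow> (Box \<phi> \<^bold>\<rightarrow> Box \<psi>) \<in> T" for \<phi> \<psi>
    proof -
      have "Box (Var p \<^bold>\<rightarrow> Var q) \<^bold>\<rightarrow> (Box (Var p) \<^bold>\<rightarrow> Box (Var q)) \<in> K_logic B" using K by blast
      then have "subst (Var(p := \<phi>, q := \<psi>)) (Box (Var p \<^bold>\<rightarrow> Var q) \<^bold>\<rightarrow> (Box (Var p) \<^bold>\<rightarrow> Box (Var q))) \<in> K_logic B"
        using K unfolding closed_uniform_subst_def by blast
      then show ?thesis using \<open>p \<noteq> q\<close> KT by auto
    qed
    have cong: "subst (Var(p := \<phi>)) \<chi> \<^bold>\<leftrightarrow> subst (Var(p := \<psi>)) \<chi> \<in> T" if eq: "\<phi> \<^bold>\<leftrightarrow> \<psi> \<in> T" for \<phi> \<psi> \<chi> p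
    proof (induction \<chi>)
      case (Var q)
      then show ?case using eq tauts(2) by simp
    next
      case (Neg \<chi>)
      then show ?case unfolding subst.simps by (rule mp[OF tauts(7)])
    next
      case (Oplus \<chi>1 \<chi>2)
      then show ?case unfolding subst.simps by (rule mp[OF mp[OF tauts(8)]])
    next
      case (Box \<chi>)
      have "Box (subst (Var(p := \<phi>)) \<chi>) \<^bold>\<rightarrow> Box (subst (Var(p := \<psi>)) \<chi>) \<in> T"
        "Box (subst (Var(p := \<psi>)) \<chi>) \<^bold>\<rightarrow> Box (subst (Var(p := \<phi>)) \<chi>) \<in> T"
        using N[unfolded closed_nec_def, rule_format, OF mp[OF tauts(4) Box], THEN mp[OF ax]]
          N[unfolded closed_nec_def, rule_format, OF mp[OF tauts(5) Box], THEN mp[OF ax]] .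
      then show ?case unfolding subst.simps by (rule mp[OF mp[OF tauts(6)]])
    qed
    show "closed_replacement T"
      unfolding closed_replacement_def
    proof safe
      fix \<phi> \<psi> \<chi> :: "'p form" and p
      assume "\<phi> \<^bold>\<leftrightarrow> \<psi> \<in> T" "subst (Var(p := \<phi>)) \<chi> \<in> T"
      then show "subst (Var(p := \<psi>)) \<chi> \<in> T" by (rule mp[OF mp[OF tauts(4) cong]])
    qed
  qed
qed

lemma deducible_iff_necessitation:
  fixes \<Gamma> :: "'p form set"
  assumes "infinite (UNIV :: 'p set)" and "axiomatic_base n B"
  shows "deducible (K_logic B) \<Gamma> \<phi> \<longleftrightarrow>
    (\<forall>T. \<Gamma> \<union> K_logic B \<subseteq> T \<longrightarrow> closed_nec T \<longrightarrow> closed_mp T \<longrightarrow> \<phi> \<in> T)"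
proof -
  have "\<Gamma> \<union> K_logic B \<subseteq> T \<and> closed_replacement T \<and> closed_mp T \<longleftrightarrow>
    \<Gamma> \<union> K_logic B \<subseteq> T \<and> closed_nec T \<and> closed_mp T" for T
    using closed_replacement_iff_closed_nec[OF assms, of T] by blast
  then show ?thesis unfolding deducible_def by blast
qed

end

theory Submission
  imports Defs "HOL-Analysis.Function_Topology"
begin

text \<open>
  Soundness is an induction on derivations. Over an \<open>n+1\<close>-valued model every formula takes its values
  in the finite set \<open>Luk n\<close>, so the infimum in the semantics of \<open>Box\<close> is a minimum, and it commutes with
  every monotone function that fixes \<open>1\<close> (\<open>Val_Box_mono_fun\<close>). The axioms that exchange \<open>Box\<close> with
  \<open>p \<oplus> p\<close>, \<open>p \<odot> p\<close> and \<open>p \<oplus> p\<^sup>m\<close> are instances of this.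

  Completeness is proved with a canonical model. By \<open>deducible_iff_necessitation\<close>, a formula that is not
  deducible from \<open>\<Gamma>\<close> lies outside some theory \<open>T \<supseteq> \<Gamma>\<close> that contains the logic and is closed under
  modus ponens and necessitation. The worlds are the maps \<open>h\<close> from formulas to
  \<open>Luk n\<close> that respect negation and \<open>\<oplus>\<close> (boxed formulas being treated as atoms) and send \<open>T\<close> to \<open>1\<close>;
  \<open>h'\<close> is a successor of \<open>h\<close> if \<open>h (Box \<psi>) = 1\<close> implies \<open>h' \<psi> = 1\<close> for all \<open>\<psi>\<close>.
  Two facts make \<open>Val \<psi> h = h \<psi>\<close> hold in this model.

  The first is strong completeness of the \<open>n+1\<close>-valued propositional logic
  (\<open>luk_strong_completeness\<close>): a set that contains all instances of the
  tautologies, is closed under modus ponens and omits \<open>\<chi>\<close> is sent to \<open>1\<close> by such a map \<open>h\<close> with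
  \<open>h \<chi> < 1\<close>. The maps in question form a compact space by Tychonoff's theorem, which reduces the claim to
  finitely many hypotheses \<open>\<theta>\<close>. These can be moved into the formula, each of them as \<open>n\<close> nested
  antecedents: if \<open>h \<theta> < 1\<close> then \<open>h \<theta> \<le> 1 - 1/n\<close>, so \<open>n\<close> antecedents \<open>\<theta>\<close> raise the value to \<open>1\<close>.

  The second is that thresholds can be expressed (\<open>threshold_connective\<close>): composing the maps
  \<open>x \<mapsto> x \<oplus> x\<close> and \<open>x \<mapsto> x \<odot> x\<close> yields all the maps \<open>x \<mapsto> max 0 (min 1 (2^k x - a))\<close> with
  \<open>a < 2^k\<close>, and for each \<open>i \<ge> 1\<close> one of these takes the value \<open>1\<close> at a point of \<open>Luk n\<close> exactly if
  that point is \<open>\<ge> i/n\<close>. These compositions commute with \<open>Box\<close>, so questions about the value of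
  \<open>Box \<psi>\<close> reduce to the question whether some formula \<open>Box \<chi>\<close> has the value \<open>1\<close>, and the latter is what
  the accessibility relation is about.
\<close>

section \<open>Propositional valuations and instances of tautologies\<close>

text \<open>A propositional valuation of modal formulas in \<open>Luk n\<close>. Nothing is required of boxed formulas,
  which thus behave like variables.\<close>

definition luk_hom :: "nat \<Rightarrow> ('p form \<Rightarrow> real) \<Rightarrow> bool" where
  "luk_hom n h \<longleftrightarrow> (\<forall>\<phi>. h \<phi> \<in> Luk n) \<and> (\<forall>\<phi>. h (Neg \<phi>) = 1 - h \<phi>) \<and>
     (\<forall>\<phi> \<psi>. h (\<phi> \<oplus> \<psi>) = min (h \<phi> + h \<psi>) 1)"

lemma luk_homD:
  assumes "luk_hom n h"
  shows luk_hom_Luk: "h \<phi> \<in> Luk n"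
    and luk_hom_nonneg: "0 \<le> h \<phi>"
    and luk_hom_le_1: "h \<phi> \<le> 1"
    and luk_hom_Neg: "h (Neg \<phi>) = 1 - h \<phi>"
    and luk_hom_Oplus: "h (\<phi> \<oplus> \<psi>) = min (h \<phi> + h \<psi>) 1"
  using assms by (auto simp: luk_hom_def dest: Luk_unit)

lemma luk_hom_Iff:
  assumes "luk_hom n h" "h (\<phi> \<^bold>\<leftrightarrow> \<psi>) = 1"
  shows "h \<phi> = h \<psi>"
  using assms(2) luk_hom_le_1[OF assms(1), of \<phi>] luk_hom_le_1[OF assms(1), of \<psi>]
  by (simp add: luk_hom_Neg[OF assms(1)] luk_hom_Oplus[OF assms(1)] min_def split: if_splits)

lemma Luk_finite: "finite (Luk n)"
  unfolding Luk_def by simp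

lemma one_Luk: "n \<ge> 1 \<Longrightarrow> 1 \<in> Luk n"
  unfolding Luk_def by (auto intro!: exI[of _ n])

lemma Luk_less_1:
  assumes "n \<ge> 1" "x \<in> Luk n" "x < 1"
  shows "real n * (1 - x) \<ge> 1"
proof -
  obtain i where i: "x = real i / real n" "i \<le> n" using assms(2) unfolding Luk_def by auto
  have "i < n" using i assms by (cases "i = n") auto
  then have "real i + 1 \<le> real n" by linarith
  then show ?thesis using i assms(1) by (simp add: field_simps)
qed

text \<open>The subformulas at which a propositional valuation may be prescribed freely.\<close>

primrec atoms :: "'p form \<Rightarrow> 'p form set" where
  "atoms (Var p) = {Var p}"
| "atoms (Neg \<phi>) = atoms \<phi>"
| "atoms (\<phi> \<oplus> \<psi>) = atoms \<phi> \<union> atoms \<psi>"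
| "atoms (Box \<phi>) = {Box \<phi>}"

text \<open>The box-free formula that results from replacing each atom \<open>\<alpha>\<close> by the variable \<open>f \<alpha>\<close>.\<close>

primrec skeleton :: "('p form \<Rightarrow> 'p) \<Rightarrow> 'p form \<Rightarrow> 'p form" where
  "skeleton f (Var p) = Var (f (Var p))"
| "skeleton f (Neg \<phi>) = Neg (skeleton f \<phi>)"
| "skeleton f (\<phi> \<oplus> \<psi>) = skeleton f \<phi> \<oplus> skeleton f \<psi>"
| "skeleton f (Box \<phi>) = Var (f (Box \<phi>))"

text \<open>The propositional valuation with prescribed values at the atoms.\<close>

primrec atom_extension :: "('p form \<Rightarrow> real) \<Rightarrow> 'p form \<Rightarrow> real" where
  "atom_extension g (Var p) = g (Var p)"
| "atom_extension g (Neg \<phi>) = 1 - atom_extension g \<phi>"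
| "atom_extension g (\<phi> \<oplus> \<psi>) = min (atom_extension g \<phi> + atom_extension g \<psi>) 1"
| "atom_extension g (Box \<phi>) = g (Box \<phi>)"

lemma finite_atoms: "finite (atoms \<phi>)"
  by (induction \<phi>) auto

lemma box_free_skeleton: "box_free (skeleton f \<phi>)"
  by (induction \<phi>) auto

lemma eval_skeleton: "eval v (skeleton f \<phi>) = atom_extension (\<lambda>\<alpha>. v (f \<alpha>)) \<phi>"
  by (induction \<phi>) auto

lemma subst_skeleton:
  assumes "\<And>\<alpha>. \<alpha> \<in> atoms \<phi> \<Longrightarrow> \<sigma> (f \<alpha>) = \<alpha>"
  shows "subst \<sigma> (skeleton f \<phi>) = \<phi>"
  using assms by (induction \<phi>) auto

lemma luk_hom_atom_extension:
  assumes "n \<ge> 1" "\<And>\<alpha>. g \<alpha> \<in> Luk n"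
  shows "luk_hom n (atom_extension g)"
proof -
  have "atom_extension g \<phi> \<in> Luk n" for \<phi>
    by (induction \<phi>) (use assms Luk_Neg Luk_Oplus in auto)
  then show ?thesis by (simp add: luk_hom_def)
qed

text \<open>Infinitely many variables are needed here: the atoms of \<open>\<phi>\<close> must be replaced by distinct variables.\<close>

lemma luk_hom_valid_imp_instance:
  fixes \<phi> :: "'p form"
  assumes "infinite (UNIV :: 'p set)" "n \<ge> 1"
    and valid: "\<And>h. luk_hom n h \<Longrightarrow> h \<phi> = 1"
  obtains \<sigma> \<phi>\<^sub>0 where "\<phi>\<^sub>0 \<in> luk_logic n" "\<phi> = subst \<sigma> \<phi>\<^sub>0"
proof -
  obtain P :: "'p set" where P: "finite P" "card P = card (atoms \<phi>)"
    using infinite_arbitrarily_large[OF assms(1)] by blast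
  then obtain f :: "'p form \<Rightarrow> 'p" where f: "inj_on f (atoms \<phi>)"
    using finite_same_card_bij[OF finite_atoms P(1) P(2)[symmetric]] bij_betw_imp_inj_on by blast
  have "subst (inv_into (atoms \<phi>) f) (skeleton f \<phi>) = \<phi>"
    by (rule subst_skeleton) (simp add: f)
  moreover have "skeleton f \<phi> \<in> luk_logic n"
    unfolding luk_logic_def
    using valid[OF luk_hom_atom_extension[OF assms(2)]] by (simp add: box_free_skeleton eval_skeleton)
  ultimately show ?thesis using that by metis
qed

section \<open>Strong completeness of the finite-valued propositional logic\<close>

text \<open>\<open>imps k \<theta> \<chi>\<close> is the formula \<open>\<theta> \<rightarrow> (\<theta> \<rightarrow> \<dots> \<rightarrow> (\<theta> \<rightarrow> \<chi>))\<close> with \<open>k\<close> antecedents. It plays the role of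
  \<open>\<theta>\<^sup>k \<rightarrow> \<chi>\<close>, in a form to which modus ponens applies directly.\<close>

definition imps :: "nat \<Rightarrow> 'p form \<Rightarrow> 'p form \<Rightarrow> 'p form" where
  "imps k \<theta> \<chi> = ((\<lambda>\<psi>. \<theta> \<^bold>\<rightarrow> \<psi>) ^^ k) \<chi>"

lemma luk_hom_imps:
  assumes "luk_hom n h"
  shows "h (imps k \<theta> \<chi>) = min (h \<chi> + real k * (1 - h \<theta>)) 1"
proof (induction k)
  case 0
  then show ?case using luk_hom_le_1[OF assms] by (simp add: imps_def)
next
  case (Suc k)
  have "h (imps (Suc k) \<theta> \<chi>) = min (h (imps k \<theta> \<chi>) + (1 - h \<theta>)) 1"
    by (simp add: imps_def luk_hom_Neg[OF assms] luk_hom_Oplus[OF assms])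
  then show ?case using Suc luk_hom_le_1[OF assms, of \<theta>] by (auto simp: min_def algebra_simps)
qed

lemma mp_imps:
  assumes "closed_mp \<Delta>" "\<theta> \<in> \<Delta>" "imps k \<theta> \<chi> \<in> \<Delta>"
  shows "\<chi> \<in> \<Delta>"
  using assms(3)
proof (induction k)
  case (Suc k)
  then have "\<theta> \<^bold>\<rightarrow> imps k \<theta> \<chi> \<in> \<Delta>" by (simp add: imps_def)
  then show ?case using assms(1,2) Suc.IH unfolding closed_mp_def by blast
qed (simp add: imps_def)

lemma mp_foldr_imps:
  assumes "closed_mp \<Delta>" "set \<theta>s \<subseteq> \<Delta>" "foldr (imps k) \<theta>s \<chi> \<in> \<Delta>"
  shows "\<chi> \<in> \<Delta>"
  using assms(2,3)
proof (induction \<theta>s)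
  case (Cons \<theta> \<theta>s)
  then have "foldr (imps k) \<theta>s \<chi> \<in> \<Delta>" using mp_imps[OF assms(1), of \<theta>] by simp
  then show ?case using Cons by simp
qed simp

lemma luk_hom_foldr_imps:
  assumes "n \<ge> 1" "luk_hom n h" "(\<forall>\<theta>\<in>set \<theta>s. h \<theta> = 1) \<longrightarrow> h \<chi> = 1"
  shows "h (foldr (imps n) \<theta>s \<chi>) = 1"
  using assms(3)
proof (induction \<theta>s)
  case (Cons \<theta> \<theta>s)
  have *: "h (foldr (imps n) (\<theta> # \<theta>s) \<chi>)
      = min (h (foldr (imps n) \<theta>s \<chi>) + real n * (1 - h \<theta>)) 1"
    by (simp add: luk_hom_imps[OF assms(2)])
  show ?case
  proof (cases "h \<theta> = 1")
    case True
    then show ?thesis using Cons * by simp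
  next
    case False
    then have "h \<theta> < 1" using luk_hom_le_1[OF assms(2), of \<theta>] by linarith
    then have "real n * (1 - h \<theta>) \<ge> 1" using Luk_less_1 luk_hom_Luk[OF assms(2)] assms(1) by blast
    then show ?thesis using * luk_hom_nonneg[OF assms(2), of "foldr (imps n) \<theta>s \<chi>"] by simp
  qed
qed simp

lemma compact_luk_homs:
  fixes \<chi> :: "'p form"
  assumes "n \<ge> 1"
  shows "compact {h. luk_hom n h \<and> h \<chi> < 1}"
proof -
  have "compactin (product_topology (\<lambda>_::'p form. euclidean) UNIV) (PiE UNIV (\<lambda>_. Luk n))"
    by (simp add: compactin_PiE Luk_finite finite_imp_compact)
  then have c: "compact (PiE UNIV (\<lambda>_::'p form. Luk n))"
    by (simp add: euclidean_product_topology)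
  \<comment> \<open>As values lie in \<open>Luk n\<close>, the condition \<open>h \<chi> < 1\<close> is a closed one.\<close>
  have lt: "h \<chi> < 1 \<longleftrightarrow> 1 \<le> real n * (1 - h \<chi>)" if "luk_hom n h" for h
  proof (cases "h \<chi> = 1")
    case False
    then have "h \<chi> < 1" using luk_hom_le_1[OF that, of \<chi>] by simp
    then show ?thesis using Luk_less_1[OF assms luk_hom_Luk[OF that]] by blast
  qed simp
  have eq: "{h. luk_hom n h \<and> h \<chi> < 1} = PiE UNIV (\<lambda>_. Luk n) \<inter>
      ((\<Inter>\<phi>. {h. h (Neg \<phi>) = 1 - h \<phi>}) \<inter> (\<Inter>\<phi>. \<Inter>\<psi>. {h. h (\<phi> \<oplus> \<psi>) = min (h \<phi> + h \<psi>) 1}) \<inter>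
       {h. 1 \<le> real n * (1 - h \<chi>)})"
    (is "?A = ?B")
  proof (rule set_eqI)
    fix h
    have "h \<in> ?A \<longleftrightarrow> luk_hom n h \<and> 1 \<le> real n * (1 - h \<chi>)"
      unfolding mem_Collect_eq by (rule conj_cong[OF refl lt])
    moreover have "h \<in> ?B \<longleftrightarrow> luk_hom n h \<and> 1 \<le> real n * (1 - h \<chi>)"
      by (simp add: luk_hom_def PiE_UNIV_domain Pi_iff conj_ac)
    ultimately show "h \<in> ?A \<longleftrightarrow> h \<in> ?B" by (rule trans[OF _ sym])
  qed
  have "closed {h :: 'p form \<Rightarrow> real. h (Neg \<phi>) = 1 - h \<phi>}" for \<phi>
    by (intro closed_Collect_eq continuous_intros continuous_on_product_coordinates)
  moreover have "closed {h :: 'p form \<Rightarrow> real. h (\<phi> \<oplus> \<psi>) = min (h \<phi> + h \<psi>) 1}" for \<phi> \<psi>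
    by (intro closed_Collect_eq continuous_intros continuous_on_product_coordinates)
  moreover have "closed {h :: 'p form \<Rightarrow> real. 1 \<le> real n * (1 - h \<chi>)}"
    by (intro closed_Collect_le continuous_intros continuous_on_product_coordinates)
  ultimately show ?thesis
    unfolding eq by (intro compact_Int_closed[OF c] closed_Int closed_INT) auto
qed

text \<open>Every set \<open>\<Delta>\<close> of formulas that contains all instances of the tautologies and is closed under modus
  ponens is an intersection of sets \<open>{\<theta>. h \<theta> = 1}\<close> with \<open>h\<close> a propositional valuation.\<close>

lemma luk_strong_completeness:
  fixes \<Delta> :: "'p form set"
  assumes "infinite (UNIV :: 'p set)" "n \<ge> 1" and mp: "closed_mp \<Delta>"
    and inst: "\<And>\<sigma> \<psi>. \<psi> \<in> luk_logic n \<Longrightarrow> subst \<sigma> \<psi> \<in> \<Delta>"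
    and "\<chi> \<notin> \<Delta>"
  obtains h where "luk_hom n h" "\<And>\<theta>. \<theta> \<in> \<Delta> \<Longrightarrow> h \<theta> = 1" "h \<chi> < 1"
proof -
  have "{h. luk_hom n h \<and> h \<chi> < 1} \<inter> (\<Inter>\<theta>\<in>\<Delta>. {h. h \<theta> = 1}) \<noteq> {}"
  proof (rule compact_imp_fip_image)
    show "closed {h :: 'p form \<Rightarrow> real. h \<theta> = 1}" for \<theta>
      by (intro closed_Collect_eq continuous_intros continuous_on_product_coordinates)
    fix \<Theta> assume "finite \<Theta>" "\<Theta> \<subseteq> \<Delta>"
    then obtain \<theta>s where \<theta>s: "set \<theta>s = \<Theta>" using finite_list by blast
    then have "foldr (imps n) \<theta>s \<chi> \<notin> \<Delta>"
      using mp_foldr_imps[OF mp] \<open>\<Theta> \<subseteq> \<Delta>\<close> \<open>\<chi> \<notin> \<Delta>\<close> by blast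
    then obtain h where h: "luk_hom n h" "h (foldr (imps n) \<theta>s \<chi>) \<noteq> 1"
      using luk_hom_valid_imp_instance[OF assms(1,2)] inst by metis
    then have "(\<forall>\<theta>\<in>\<Theta>. h \<theta> = 1) \<and> h \<chi> \<noteq> 1"
      using luk_hom_foldr_imps[OF assms(2) h(1)] \<theta>s by blast
    moreover have "h \<chi> \<le> 1" using luk_hom_le_1[OF h(1)] .
    ultimately have "h \<in> {h. luk_hom n h \<and> h \<chi> < 1} \<inter> (\<Inter>\<theta>\<in>\<Theta>. {h. h \<theta> = 1})"
      using h(1) by auto
    then show "{h. luk_hom n h \<and> h \<chi> < 1} \<inter> (\<Inter>\<theta>\<in>\<Theta>. {h. h \<theta> = 1}) \<noteq> {}" by blast
  qed (rule compact_luk_homs[OF assms(2)])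
  then show ?thesis using that by blast
qed

section \<open>Threshold connectives\<close>

text \<open>Valuations for which \<open>Box\<close> commutes with \<open>\<phi> \<mapsto> \<phi> \<oplus> \<phi>\<close> and \<open>\<phi> \<mapsto> \<phi> \<odot> \<phi>\<close>.\<close>

definition box_hom :: "nat \<Rightarrow> ('p form \<Rightarrow> real) \<Rightarrow> bool" where
  "box_hom n h \<longleftrightarrow> luk_hom n h \<and> (\<forall>\<phi>. h (Box (\<phi> \<oplus> \<phi>)) = h (Box \<phi> \<oplus> Box \<phi>)) \<and>
     (\<forall>\<phi>. h (Box (\<phi> \<odot> \<phi>)) = h (Box \<phi> \<odot> Box \<phi>))"

lemma dyadic_connective:
  assumes "a < 2 ^ k"
  shows "\<exists>t :: 'p form \<Rightarrow> 'p form. \<forall>h \<psi>. box_hom n h \<longrightarrow>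
    h (t \<psi>) = max 0 (min 1 (2 ^ k * h \<psi> - real a)) \<and>
    h (Box (t \<psi>)) = max 0 (min 1 (2 ^ k * h (Box \<psi>) - real a))"
  using assms
proof (induction k arbitrary: a)
  case 0
  then show ?case
    by (intro exI[of _ "\<lambda>\<psi>. \<psi>"]) (auto simp: box_hom_def luk_hom_nonneg luk_hom_le_1)
next
  case (Suc k)
  define b where "b = a div 2"
  have "b < 2 ^ k" using Suc.prems by (auto simp: b_def)
  then obtain t :: "'p form \<Rightarrow> 'p form" where t: "\<And>h \<psi>. box_hom n h \<Longrightarrow>
      h (t \<psi>) = max 0 (min 1 (2 ^ k * h \<psi> - real b)) \<and>
      h (Box (t \<psi>)) = max 0 (min 1 (2 ^ k * h (Box \<psi>) - real b))"
    using Suc.IH by blast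
  \<comment> \<open>The last binary digit of \<open>a\<close> decides which of the two operations comes last.\<close>
  have "a = 2 * b \<or> a = 2 * b + 1" by (auto simp: b_def)
  then show ?case
  proof
    assume a: "a = 2 * b"
    show ?thesis
    proof (rule exI[of _ "\<lambda>\<psi>. t \<psi> \<oplus> t \<psi>"], intro allI impI)
      fix h :: "'p form \<Rightarrow> real" and \<psi> assume h: "box_hom n h"
      then have lh: "luk_hom n h" and "h (Box (t \<psi> \<oplus> t \<psi>)) = h (Box (t \<psi>) \<oplus> Box (t \<psi>))"
        by (auto simp: box_hom_def)
      then show "h (t \<psi> \<oplus> t \<psi>) = max 0 (min 1 (2 ^ Suc k * h \<psi> - real a)) \<and>
        h (Box (t \<psi> \<oplus> t \<psi>)) = max 0 (min 1 (2 ^ Suc k * h (Box \<psi>) - real a))"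
        using t[OF h, of \<psi>] by (auto simp: luk_hom_Oplus[OF lh] a min_def max_def)
    qed
  next
    assume a: "a = 2 * b + 1"
    show ?thesis
    proof (rule exI[of _ "\<lambda>\<psi>. t \<psi> \<odot> t \<psi>"], intro allI impI)
      fix h :: "'p form \<Rightarrow> real" and \<psi> assume h: "box_hom n h"
      then have lh: "luk_hom n h" and "h (Box (t \<psi> \<odot> t \<psi>)) = h (Box (t \<psi>) \<odot> Box (t \<psi>))"
        by (auto simp: box_hom_def)
      then show "h (t \<psi> \<odot> t \<psi>) = max 0 (min 1 (2 ^ Suc k * h \<psi> - real a)) \<and>
        h (Box (t \<psi> \<odot> t \<psi>)) = max 0 (min 1 (2 ^ Suc k * h (Box \<psi>) - real a))"
        using t[OF h, of \<psi>]
        by (auto simp: luk_hom_Oplus[OF lh] luk_hom_Neg[OF lh] a min_def max_def)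
    qed
  qed
qed

lemma threshold_connective:
  assumes "1 \<le> i" "i \<le> n"
  obtains t :: "'p form \<Rightarrow> 'p form"
  where "\<And>h \<psi>. box_hom n h \<Longrightarrow> h (t \<psi>) = 1 \<longleftrightarrow> h \<psi> \<ge> real i / real n"
    and "\<And>h \<psi>. box_hom n h \<Longrightarrow> h (Box (t \<psi>)) = 1 \<longleftrightarrow> h (Box \<psi>) \<ge> real i / real n"
proof -
  \<comment> \<open>\<open>q / 2^n\<close> is the largest multiple of \<open>1 / 2^n\<close> that is \<open>\<le> i/n\<close>; as \<open>2^n > n\<close>, it exceeds \<open>(i-1)/n\<close>.\<close>
  define q where "q = (2 ^ n * i) div n"
  have n: "n > 0" using assms by simp
  have big: "n < 2 ^ n" by (rule less_exp)
  have q_upper: "n * q \<le> 2 ^ n * i" by (simp add: q_def)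
  have q_lower: "2 ^ n * i < n * q + n"
    using mult_div_mod_eq[of n "2 ^ n * i"] mod_less_divisor[OF n, of "2 ^ n * i"]
    unfolding q_def by linarith
  have "n \<le> 2 ^ n * i" using big assms(1) by (simp add: less_imp_le mult_le_mono[of n "2 ^ n" 1 i, simplified])
  then have q1: "q \<ge> 1" using n by (simp add: q_def Suc_le_eq div_greater_zero_iff)
  have "n * q \<le> n * 2 ^ n" using q_upper assms(2) by (metis le_trans mult.commute mult_le_mono2)
  then have q2: "q \<le> 2 ^ n" using n by simp
  have key: "max 0 (min 1 (2 ^ n * x - real (q - 1))) = 1 \<longleftrightarrow> x \<ge> real i / real n"
    if "x \<in> Luk n" for x
  proof -
    obtain j where x: "x = real j / real n" using \<open>x \<in> Luk n\<close> by (auto simp: Luk_def)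
    have "n * q \<le> 2 ^ n * j \<longleftrightarrow> i \<le> j"
    proof
      assume *: "n * q \<le> 2 ^ n * j"
      show "i \<le> j"
      proof (rule ccontr)
        assume "\<not> i \<le> j"
        then have "2 ^ n * (j + 1) \<le> 2 ^ n * i" by (intro mult_le_mono2) simp
        then show False using * q_lower big by (simp add: algebra_simps)
      qed
    next
      assume "i \<le> j"
      then have "2 ^ n * i \<le> 2 ^ n * j" by simp
      then show "n * q \<le> 2 ^ n * j" using q_upper by linarith
    qed
    then have "real n * real q \<le> 2 ^ n * real j \<longleftrightarrow> i \<le> j"
      by (metis of_nat_le_iff of_nat_mult of_nat_numeral of_nat_power)
    moreover have "max 0 (min 1 (2 ^ n * x - real (q - 1))) = 1 \<longleftrightarrow> real q \<le> 2 ^ n * x"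
      using q1 by (auto simp: of_nat_diff max_def min_def)
    ultimately show ?thesis using n by (simp add: x field_simps)
  qed
  have "q - 1 < 2 ^ n" using q1 q2 by simp
  from dyadic_connective[OF this] obtain t :: "'p form \<Rightarrow> 'p form"
    where t: "\<forall>h \<psi>. box_hom n h \<longrightarrow>
    h (t \<psi>) = max 0 (min 1 (2 ^ n * h \<psi> - real (q - 1))) \<and>
    h (Box (t \<psi>)) = max 0 (min 1 (2 ^ n * h (Box \<psi>) - real (q - 1)))" ..
  show ?thesis
  proof (rule that[of t])
    fix h :: "'p form \<Rightarrow> real" and \<psi> assume h: "box_hom n h"
    then have "h \<phi> \<in> Luk n" for \<phi> by (simp add: box_hom_def luk_hom_Luk)
    then show "h (t \<psi>) = 1 \<longleftrightarrow> h \<psi> \<ge> real i / real n"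
      "h (Box (t \<psi>)) = 1 \<longleftrightarrow> h (Box \<psi>) \<ge> real i / real n"
      by (simp_all only: t[rule_format, OF h] key)
  qed
qed

section \<open>The canonical model\<close>

text \<open>The worlds are the propositional valuations that make the theory \<open>T\<close> true.\<close>

definition canonical :: "nat \<Rightarrow> 'p form set \<Rightarrow> ('p, 'p form \<Rightarrow> real) kripke" where
  "canonical n T = \<lparr>worlds = {h. luk_hom n h \<and> (\<forall>\<theta>\<in>T. h \<theta> = 1)},
     rel = {(h, h'). (luk_hom n h \<and> (\<forall>\<theta>\<in>T. h \<theta> = 1)) \<and> (luk_hom n h' \<and> (\<forall>\<theta>\<in>T. h' \<theta> = 1)) \<and>
       (\<forall>\<psi>. h (Box \<psi>) = 1 \<longrightarrow> h' \<psi> = 1)},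
     val = (\<lambda>p h. h (Var p))\<rparr>"

lemma modal_mv_logic_instances:
  fixes L :: "'p form set"
  assumes "infinite (UNIV :: 'p set)" "modal_mv_logic L"
  shows modal_mv_logic_Imp: "Box (\<phi> \<^bold>\<rightarrow> \<psi>) \<^bold>\<rightarrow> (Box \<phi> \<^bold>\<rightarrow> Box \<psi>) \<in> L"
    and modal_mv_logic_Oplus: "Box (\<phi> \<oplus> \<phi>) \<^bold>\<leftrightarrow> (Box \<phi> \<oplus> Box \<phi>) \<in> L"
    and modal_mv_logic_Odot: "Box (\<phi> \<odot> \<phi>) \<^bold>\<leftrightarrow> (Box \<phi> \<odot> Box \<phi>) \<in> L"
proof -
  obtain p q :: 'p where "p \<noteq> q"
    using ex_new_if_finite[OF assms(1), of "{undefined}"] by auto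
  define \<sigma> where "\<sigma> = Var(p := \<phi>, q := \<psi>)"
  have \<sigma>: "\<sigma> p = \<phi>" "\<sigma> q = \<psi>" using \<open>p \<noteq> q\<close> by (auto simp: \<sigma>_def)
  have s: "subst \<sigma> \<theta> \<in> L" if "\<theta> \<in> L" for \<theta>
    using that assms(2) unfolding modal_mv_logic_def closed_uniform_subst_def by blast
  note ax = assms(2)[unfolded modal_mv_logic_def]
  show "Box (\<phi> \<^bold>\<rightarrow> \<psi>) \<^bold>\<rightarrow> (Box \<phi> \<^bold>\<rightarrow> Box \<psi>) \<in> L"
    using s[of "Box (Var p \<^bold>\<rightarrow> Var q) \<^bold>\<rightarrow> (Box (Var p) \<^bold>\<rightarrow> Box (Var q))"] ax by (simp add: \<sigma>)
  show "Box (\<phi> \<oplus> \<phi>) \<^bold>\<leftrightarrow> (Box \<phi> \<oplus> Box \<phi>) \<in> L"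
    using s[of "Box (Var p \<oplus> Var p) \<^bold>\<leftrightarrow> (Box (Var p) \<oplus> Box (Var p))"] ax by (simp add: \<sigma>)
  show "Box (\<phi> \<odot> \<phi>) \<^bold>\<leftrightarrow> (Box \<phi> \<odot> Box \<phi>) \<in> L"
    using s[of "Box (Var p \<odot> Var p) \<^bold>\<leftrightarrow> (Box (Var p) \<odot> Box (Var p))"] ax by (simp add: \<sigma>)
qed

lemma canonical_truth:
  fixes T :: "'p form set"
  assumes inf: "infinite (UNIV :: 'p set)" and n: "n \<ge> 1" and B: "axiomatic_base n B"
    and KT: "K_logic B \<subseteq> T" and nec: "closed_nec T" and mp: "closed_mp T"
    and "h \<in> worlds (canonical n T)"
  shows "Val (canonical n T) \<psi> h = h \<psi>"
  using assms(7)
proof (induction \<psi> arbitrary: h)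
  case (Box \<psi>)
  let ?R = "rel (canonical n T)"
  have worlds_iff: "h \<in> worlds (canonical n T) \<longleftrightarrow> luk_hom n h \<and> (\<forall>\<theta>\<in>T. h \<theta> = 1)" for h
    by (simp add: canonical_def)
  have rel_iff: "(h, h') \<in> ?R \<longleftrightarrow> h \<in> worlds (canonical n T) \<and> h' \<in> worlds (canonical n T) \<and>
      (\<forall>\<psi>. h (Box \<psi>) = 1 \<longrightarrow> h' \<psi> = 1)" for h h'
    by (simp add: canonical_def)
  note instances = modal_mv_logic_instances[OF inf modal_mv_logic_K, THEN subsetD[OF KT]]
  have box_hom: "box_hom n h" if "h \<in> worlds (canonical n T)" for h
    using that instances(2,3) luk_hom_Iff unfolding worlds_iff box_hom_def by blast
  have lh: "luk_hom n h" and T1: "\<And>\<theta>. \<theta> \<in> T \<Longrightarrow> h \<theta> = 1" using Box.prems by (auto simp: worlds_iff)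
  obtain i where i: "h (Box \<psi>) = real i / real n" "i \<le> n"
    using luk_hom_Luk[OF lh, of "Box \<psi>"] by (auto simp: Luk_def)
  have lower: "h (Box \<psi>) \<le> h' \<psi>" if r: "(h, h') \<in> ?R" for h'
  proof (cases "i = 0")
    case True
    then show ?thesis using i r luk_hom_nonneg[of n h' \<psi>] by (simp add: rel_iff worlds_iff)
  next
    case False
    then have "1 \<le> i" by simp
    then obtain t :: "'p form \<Rightarrow> 'p form"
      where t: "\<And>h \<psi>. box_hom n h \<Longrightarrow> h (t \<psi>) = 1 \<longleftrightarrow> h \<psi> \<ge> real i / real n"
      "\<And>h \<psi>. box_hom n h \<Longrightarrow> h (Box (t \<psi>)) = 1 \<longleftrightarrow> h (Box \<psi>) \<ge> real i / real n"
      using threshold_connective[OF _ i(2)] by blast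
    have w: "h' \<in> worlds (canonical n T)" and s: "\<And>\<psi>. h (Box \<psi>) = 1 \<Longrightarrow> h' \<psi> = 1"
      using r unfolding rel_iff by blast+
    have "h (Box (t \<psi>)) = 1" using t(2)[OF box_hom[OF Box.prems]] i(1) by simp
    then have "h' (t \<psi>) = 1" by (rule s)
    then show ?thesis using t(1)[OF box_hom[OF w]] i(1) by simp
  qed
  have attained: "\<exists>h'. (h, h') \<in> ?R \<and> h' \<psi> = h (Box \<psi>)" if "h (Box \<psi>) \<noteq> 1"
  proof -
    have "i < n" using that i n by (cases "i = n") auto
    then have "i + 1 \<le> n" by simp
    then obtain t :: "'p form \<Rightarrow> 'p form"
      where t: "\<And>h \<psi>. box_hom n h \<Longrightarrow> h (t \<psi>) = 1 \<longleftrightarrow> h \<psi> \<ge> real (i + 1) / real n"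
      "\<And>h \<psi>. box_hom n h \<Longrightarrow> h (Box (t \<psi>)) = 1 \<longleftrightarrow> h (Box \<psi>) \<ge> real (i + 1) / real n"
      using threshold_connective[OF le_add2] by blast
    define \<Delta> where "\<Delta> = {\<theta>. h (Box \<theta>) = 1}"
    have "T \<subseteq> \<Delta>" using nec T1 unfolding \<Delta>_def closed_nec_def by blast
    have "closed_mp \<Delta>"
      unfolding closed_mp_def \<Delta>_def
    proof (intro allI impI; elim CollectE; intro CollectI)
      fix \<phi> \<psi> assume "h (Box \<phi>) = 1" "h (Box (\<phi> \<^bold>\<rightarrow> \<psi>)) = 1"
      moreover have "h (Box (\<phi> \<^bold>\<rightarrow> \<psi>) \<^bold>\<rightarrow> (Box \<phi> \<^bold>\<rightarrow> Box \<psi>)) = 1"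
        by (intro T1 instances(1))
      ultimately show "h (Box \<psi>) = 1"
        using luk_hom_le_1[OF lh, of "Box \<psi>"]
        by (simp add: luk_hom_Oplus[OF lh] luk_hom_Neg[OF lh])
    qed
    moreover have "subst \<sigma> \<theta> \<in> \<Delta>" if "\<theta> \<in> luk_logic n" for \<sigma> \<theta>
      using that luk_logic_subset_K[OF B] modal_mv_logic_K[of B] KT \<open>T \<subseteq> \<Delta>\<close>
      unfolding modal_mv_logic_def closed_uniform_subst_def by blast
    moreover have "t \<psi> \<notin> \<Delta>"
      using t(2)[OF box_hom[OF Box.prems]] i n by (simp add: \<Delta>_def field_simps)
    ultimately obtain h' where h': "luk_hom n h'" "\<And>\<theta>. \<theta> \<in> \<Delta> \<Longrightarrow> h' \<theta> = 1" "h' (t \<psi>) < 1"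
      using luk_strong_completeness[OF inf n] by blast
    have w': "h' \<in> worlds (canonical n T)" using h' \<open>T \<subseteq> \<Delta>\<close> by (auto simp: worlds_iff)
    have r: "(h, h') \<in> ?R"
      using Box.prems w' h'(2) unfolding rel_iff \<Delta>_def by blast
    obtain j where j: "h' \<psi> = real j / real n" using luk_hom_Luk[OF h'(1), of \<psi>] by (auto simp: Luk_def)
    have "\<not> h' \<psi> \<ge> real (i + 1) / real n" using t(1)[OF box_hom[OF w']] h'(3) by force
    moreover have "real (i + 1) / real n \<le> real j / real n" if "i < j"
      using that by (intro divide_right_mono) auto
    ultimately have "j \<le> i" unfolding j using not_less by blast
    then have "h' \<psi> \<le> h (Box \<psi>)" using n by (simp add: i j divide_right_mono)
    then show ?thesis using r lower[OF r] by force
  qed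
  have IH: "Val (canonical n T) \<psi> h' = h' \<psi>" if "(h, h') \<in> ?R" for h'
    using Box.IH that unfolding rel_iff by blast
  have "Inf (insert 1 {Val (canonical n T) \<psi> h' |h'. (h, h') \<in> ?R}) = h (Box \<psi>)"
  proof (rule cInf_eq_minimum)
    show "h (Box \<psi>) \<in> insert 1 {Val (canonical n T) \<psi> h' |h'. (h, h') \<in> ?R}"
    proof (cases "h (Box \<psi>) = 1")
      case False
      then obtain h' where "(h, h') \<in> ?R" "h' \<psi> = h (Box \<psi>)" using attained by blast
      then show ?thesis using IH by (intro insertI2 CollectI exI[of _ h']) simp
    qed simp
    show "h (Box \<psi>) \<le> x" if "x \<in> insert 1 {Val (canonical n T) \<psi> h' |h'. (h, h') \<in> ?R}" for x
      using that
    proof (elim insertE CollectE exE conjE)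
      fix h' assume "x = Val (canonical n T) \<psi> h'" "(h, h') \<in> ?R"
      then show ?thesis using IH lower by simp
    qed (simp add: luk_hom_le_1[OF lh])
  qed
  then show ?case by simp
next
  case (Var p)
  show ?case by (simp add: canonical_def)
next
  case (Neg \<psi>)
  then have "luk_hom n h" by (simp add: canonical_def)
  then show ?case using Neg by (simp add: luk_hom_Neg)
next
  case (Oplus \<psi>1 \<psi>2)
  then have "luk_hom n h" by (simp add: canonical_def)
  then show ?case using Oplus by (simp add: luk_hom_Oplus)
qed

lemma completeness:
  fixes \<Gamma> :: "'p form set" and \<phi> :: "'p form"
  assumes inf: "infinite (UNIV :: 'p set)" and n: "n \<ge> 1" and B: "axiomatic_base n B"
    and "\<not> deducible (K_logic B) \<Gamma> \<phi>"
  shows "\<exists>M :: ('p, 'p form \<Rightarrow> real) kripke. valued_model n M \<and> model_of M \<Gamma> \<and> \<not> true_in M \<phi>"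
proof -
  obtain T where T: "\<Gamma> \<union> K_logic B \<subseteq> T" "closed_nec T" "closed_mp T" "\<phi> \<notin> T"
    using assms(4) unfolding deducible_iff_necessitation[OF inf B] by blast
  have KT: "K_logic B \<subseteq> T" using T by blast
  have "subst \<sigma> \<psi> \<in> T" if "\<psi> \<in> luk_logic n" for \<sigma> \<psi>
    using that luk_logic_subset_K[OF B] modal_mv_logic_K[of B] KT
    unfolding modal_mv_logic_def closed_uniform_subst_def by blast
  then obtain h where h: "luk_hom n h" "\<And>\<theta>. \<theta> \<in> T \<Longrightarrow> h \<theta> = 1" "h \<phi> < 1"
    using luk_strong_completeness[OF inf n T(3) _ T(4)] by blast
  then have hw: "h \<in> worlds (canonical n T)" by (simp add: canonical_def)
  note truth = canonical_truth[OF inf n B KT T(2,3)]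
  have "valued_model n (canonical n T)"
    using hw unfolding valued_model_def kripke_model_def
    by (auto simp: canonical_def luk_hom_Luk luk_hom_nonneg luk_hom_le_1)
  moreover have "model_of (canonical n T) \<Gamma>"
    unfolding model_of_def true_in_def using T(1) by (auto simp: truth) (auto simp: canonical_def)
  moreover have "\<not> true_in (canonical n T) \<phi>"
    unfolding true_in_def using hw h(3) truth[OF hw, of \<phi>] by force
  ultimately show ?thesis by blast
qed

section \<open>Soundness\<close>

lemma valued_modelD:
  assumes "valued_model n M"
  shows "w \<in> worlds M \<Longrightarrow> val M p w \<in> Luk n"
    and "(w, w') \<in> rel M \<Longrightarrow> w' \<in> worlds M"
  using assms by (auto simp: valued_model_def kripke_model_def)

lemma Val_Luk_aux:
  assumes "n \<ge> 1" "\<forall>w'. (w, w') \<in> rel M \<longrightarrow> Val M \<phi> w' \<in> Luk n"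
  defines "A \<equiv> insert 1 {Val M \<phi> w' |w'. (w, w') \<in> rel M}"
  shows "A \<subseteq> Luk n" "finite A" "Val M (Box \<phi>) w = Min A"
proof -
  show "A \<subseteq> Luk n" using assms one_Luk by (auto simp: A_def)
  then show "finite A" using Luk_finite finite_subset by blast
  then show "Val M (Box \<phi>) w = Min A"
    by (simp add: A_def cInf_eq_Min)
qed

lemma Val_Luk:
  assumes "n \<ge> 1" "valued_model n M" "w \<in> worlds M"
  shows "Val M \<phi> w \<in> Luk n"
  using assms(3)
proof (induction \<phi> arbitrary: w)
  case (Box \<phi>)
  have "\<forall>w'. (w, w') \<in> rel M \<longrightarrow> Val M \<phi> w' \<in> Luk n"
    using Box.IH valued_modelD(2)[OF assms(2)] by blast
  note aux = Val_Luk_aux[OF assms(1), of w M \<phi>, OF this]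
  show ?case unfolding aux(3) by (rule subsetD[OF aux(1) Min_in[OF aux(2)]]) simp
qed (simp_all add: valued_modelD(1)[OF assms(2)] Luk_Neg[OF assms(1)] Luk_Oplus[OF assms(1)])

lemma Val_unit:
  assumes "n \<ge> 1" "valued_model n M" "w \<in> worlds M"
  shows "0 \<le> Val M \<phi> w \<and> Val M \<phi> w \<le> 1"
  using Val_Luk[OF assms] Luk_unit by blast

lemma Val_Box_Min:
  assumes "n \<ge> 1" "valued_model n M"
  shows "finite {Val M \<phi> w' |w'. (w, w') \<in> rel M}"
    and "Val M (Box \<phi>) w = Min (insert 1 {Val M \<phi> w' |w'. (w, w') \<in> rel M})"
proof -
  have "\<forall>w'. (w, w') \<in> rel M \<longrightarrow> Val M \<phi> w' \<in> Luk n"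
    using Val_Luk[OF assms] valued_modelD(2)[OF assms(2)] by blast
  note aux = Val_Luk_aux[OF assms(1) this]
  show "finite {Val M \<phi> w' |w'. (w, w') \<in> rel M}" using aux(2) by simp
  show "Val M (Box \<phi>) w = Min (insert 1 {Val M \<phi> w' |w'. (w, w') \<in> rel M})" by (rule aux(3))
qed

lemma Val_Box_le:
  assumes "n \<ge> 1" "valued_model n M" "(w, w') \<in> rel M"
  shows "Val M (Box \<phi>) w \<le> Val M \<phi> w'"
  unfolding Val_Box_Min(2)[OF assms(1,2)]
  by (rule Min_le) (use Val_Box_Min(1)[OF assms(1,2)] assms(3) in auto)

lemma Val_Box_attained:
  assumes "n \<ge> 1" "valued_model n M"
  shows "Val M (Box \<phi>) w = 1 \<or> (\<exists>w'. (w, w') \<in> rel M \<and> Val M (Box \<phi>) w = Val M \<phi> w')"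
  using Min_in[of "insert 1 {Val M \<phi> w' |w'. (w, w') \<in> rel M}"] Val_Box_Min[OF assms, of \<phi> w]
  by auto

lemma Val_Box_mono_fun:
  assumes "n \<ge> 1" "valued_model n M" "mono f" "f 1 = 1"
    and "\<And>w. Val M \<psi> w = f (Val M \<phi> w)"
  shows "Val M (Box \<psi>) w = f (Val M (Box \<phi>) w)"
proof -
  have "{Val M \<psi> w' |w'. (w, w') \<in> rel M} = f ` {Val M \<phi> w' |w'. (w, w') \<in> rel M}"
    using assms(5) by auto
  then show ?thesis
    unfolding Val_Box_Min(2)[OF assms(1,2)]
    using mono_Min_commute[OF assms(3), of "insert 1 {Val M \<phi> w' |w'. (w, w') \<in> rel M}"]
      Val_Box_Min(1)[OF assms(1,2)] assms(4) by simp
qed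

text \<open>The truth function of \<open>p\<^sup>m\<close>.\<close>

definition luk_pow :: "nat \<Rightarrow> real \<Rightarrow> real" where
  "luk_pow m x = ((\<lambda>y. 1 - min (1 - x + (1 - y)) 1) ^^ (m - 1)) x"

lemma Val_fpow: "Val M (fpow \<phi> m) w = luk_pow m (Val M \<phi> w)"
proof -
  have "Val M (((\<lambda>\<psi>. \<phi> \<odot> \<psi>) ^^ k) \<phi>) w
      = ((\<lambda>y. 1 - min (1 - Val M \<phi> w + (1 - y)) 1) ^^ k) (Val M \<phi> w)" for k
    by (induction k) auto
  then show ?thesis by (simp add: fpow_def luk_pow_def)
qed

lemma mono_luk_pow: "mono (luk_pow m)"
proof (rule monoI)
  fix x y :: real assume "x \<le> y"
  have "((\<lambda>z. 1 - min (1 - x + (1 - z)) 1) ^^ k) x \<le> ((\<lambda>z. 1 - min (1 - y + (1 - z)) 1) ^^ k) y" for k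
    by (induction k) (use \<open>x \<le> y\<close> in auto)
  then show "luk_pow m x \<le> luk_pow m y" by (simp add: luk_pow_def)
qed

lemma luk_pow_1: "luk_pow m 1 = 1"
proof -
  have "((\<lambda>z. 1 - min (1 - 1 + (1 - z)) 1) ^^ k) 1 = (1::real)" for k
    by (induction k) auto
  then show ?thesis by (simp add: luk_pow_def)
qed

lemma Val_subst: "Val M (subst \<sigma> \<phi>) w = Val (M\<lparr>val := \<lambda>p. Val M (\<sigma> p)\<rparr>) \<phi> w"
  by (induction \<phi> arbitrary: w) auto

lemma Val_box_free: "box_free \<phi> \<Longrightarrow> Val M \<phi> w = eval (\<lambda>p. val M p w) \<phi>"
  by (induction \<phi>) auto

lemma Val_Imp_1: "Val M (\<phi> \<^bold>\<rightarrow> \<psi>) w = 1 \<longleftrightarrow> Val M \<phi> w \<le> Val M \<psi> w"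
  by (auto simp: min_def)

lemma eval_Imp_1: "eval v (\<phi> \<^bold>\<rightarrow> \<psi>) = 1 \<longleftrightarrow> eval v \<phi> \<le> eval v \<psi>"
  by (auto simp: min_def)

lemma Val_Iff_1: "Val M \<phi> w = Val M \<psi> w \<Longrightarrow> Val M (\<phi> \<^bold>\<leftrightarrow> \<psi>) w = 1"
  by simp

lemma modal_mv_logic_valid:
  assumes n: "n \<ge> 1"
  shows "modal_mv_logic {\<phi>. \<forall>M :: ('p, 'w) kripke. valued_model n M \<longrightarrow> true_in M \<phi>}"
    (is "modal_mv_logic ?L")
proof -
  have taut: "\<phi> \<in> ?L" if "box_free \<phi>" "\<And>v. (\<And>p. 0 \<le> v p \<and> v p \<le> 1) \<Longrightarrow> eval v \<phi> = 1" for \<phi>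
  proof (intro CollectI allI impI)
    fix M :: "('p, 'w) kripke" assume "valued_model n M"
    then show "true_in M \<phi>"
      using that unfolding true_in_def
      by (auto simp: Val_box_free valued_model_def kripke_model_def)
  qed
  have box_fun: "Box \<psi> \<^bold>\<leftrightarrow> \<chi> \<in> ?L"
    if f: "mono f" "f 1 = 1" and \<psi>: "\<And>(M :: ('p, 'w) kripke) w. Val M \<psi> w = f (Val M (Var p) w)"
      and \<chi>: "\<And>(M :: ('p, 'w) kripke) w. Val M \<chi> w = f (Val M (Box (Var p)) w)" for f p and \<psi> \<chi> :: "'p form"
  proof (intro CollectI allI impI)
    fix M :: "('p, 'w) kripke" assume M: "valued_model n M"
    have "Val M (Box \<psi>) w = Val M \<chi> w" for w
      using Val_Box_mono_fun[OF n M f \<psi>] \<chi>[of M w] by simp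
    then show "true_in M (Box \<psi> \<^bold>\<leftrightarrow> \<chi>)" unfolding true_in_def by (intro ballI Val_Iff_1)
  qed
  have "closed_mp ?L"
    unfolding closed_mp_def
  proof (intro allI impI CollectI)
    fix \<phi> \<psi> :: "'p form" and M :: "('p, 'w) kripke"
    assume "\<phi> \<in> ?L" "\<phi> \<^bold>\<rightarrow> \<psi> \<in> ?L" and M: "valued_model n M"
    then have *: "Val M \<phi> w = 1" "Val M \<phi> w \<le> Val M \<psi> w" if "w \<in> worlds M" for w
      using that unfolding mem_Collect_eq true_in_def Val_Imp_1 by blast+
    have "Val M \<psi> w = 1" if "w \<in> worlds M" for w
      using *[OF that] Val_unit[OF n M that, of \<psi>] by linarith
    then show "true_in M \<psi>" unfolding true_in_def by blast
  qed
  moreover have "closed_uniform_subst ?L"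
    unfolding closed_uniform_subst_def
  proof (intro allI impI CollectI)
    fix \<phi> :: "'p form" and \<sigma> and M :: "('p, 'w) kripke"
    assume "\<phi> \<in> ?L" and M: "valued_model n M"
    have "valued_model n (M\<lparr>val := \<lambda>p. Val M (\<sigma> p)\<rparr>)"
      using M Val_Luk[OF n M] Val_unit[OF n M] by (simp add: valued_model_def kripke_model_def)
    then have "true_in (M\<lparr>val := \<lambda>p. Val M (\<sigma> p)\<rparr>) \<phi>" using \<open>\<phi> \<in> ?L\<close> by blast
    then show "true_in M (subst \<sigma> \<phi>)" by (simp add: true_in_def Val_subst)
  qed
  moreover have "closed_nec ?L"
    unfolding closed_nec_def
  proof (intro allI impI CollectI)
    fix \<phi> :: "'p form" and M :: "('p, 'w) kripke"
    assume "\<phi> \<in> ?L" and M: "valued_model n M"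
    then show "true_in M (Box \<phi>)"
      unfolding true_in_def using Val_Box_attained[OF n M, of \<phi>] valued_modelD(2)[OF M]
      by (fastforce simp: true_in_def simp del: Val.simps)
  qed
  moreover have "Var p \<^bold>\<rightarrow> (Var q \<^bold>\<rightarrow> Var p) \<in> ?L" for p q
  proof (rule taut)
    fix v :: "'p \<Rightarrow> real" assume v: "\<And>p. 0 \<le> v p \<and> v p \<le> 1"
    show "eval v (Var p \<^bold>\<rightarrow> (Var q \<^bold>\<rightarrow> Var p)) = 1"
      unfolding eval_Imp_1 eval.simps using v[of p] v[of q] by linarith
  qed simp
  moreover have "(Var p \<^bold>\<rightarrow> Var q) \<^bold>\<rightarrow> ((Var q \<^bold>\<rightarrow> Var r) \<^bold>\<rightarrow> (Var p \<^bold>\<rightarrow> Var r)) \<in> ?L" for p q r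
  proof (rule taut)
    fix v :: "'p \<Rightarrow> real" assume v: "\<And>p. 0 \<le> v p \<and> v p \<le> 1"
    show "eval v ((Var p \<^bold>\<rightarrow> Var q) \<^bold>\<rightarrow> ((Var q \<^bold>\<rightarrow> Var r) \<^bold>\<rightarrow> (Var p \<^bold>\<rightarrow> Var r))) = 1"
      unfolding eval_Imp_1 eval.simps using v[of p] v[of q] v[of r] by linarith
  qed simp
  moreover have "((Var p \<^bold>\<rightarrow> Var q) \<^bold>\<rightarrow> Var q) \<^bold>\<rightarrow> ((Var q \<^bold>\<rightarrow> Var p) \<^bold>\<rightarrow> Var p) \<in> ?L" for p q
  proof (rule taut)
    fix v :: "'p \<Rightarrow> real" assume v: "\<And>p. 0 \<le> v p \<and> v p \<le> 1"
    show "eval v (((Var p \<^bold>\<rightarrow> Var q) \<^bold>\<rightarrow> Var q) \<^bold>\<rightarrow> ((Var q \<^bold>\<rightarrow> Var p) \<^bold>\<rightarrow> Var p)) = 1"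
      unfolding eval_Imp_1 eval.simps using v[of p] v[of q] by linarith
  qed simp
  moreover have "(Neg (Var p) \<^bold>\<rightarrow> Neg (Var q)) \<^bold>\<rightarrow> (Var q \<^bold>\<rightarrow> Var p) \<in> ?L" for p q
  proof (rule taut)
    fix v :: "'p \<Rightarrow> real" assume v: "\<And>p. 0 \<le> v p \<and> v p \<le> 1"
    show "eval v ((Neg (Var p) \<^bold>\<rightarrow> Neg (Var q)) \<^bold>\<rightarrow> (Var q \<^bold>\<rightarrow> Var p)) = 1"
      unfolding eval_Imp_1 eval.simps using v[of p] v[of q] by linarith
  qed simp
  moreover have "Box (Var p \<^bold>\<rightarrow> Var q) \<^bold>\<rightarrow> (Box (Var p) \<^bold>\<rightarrow> Box (Var q)) \<in> ?L" for p q
  proof (intro CollectI allI impI)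
    fix M :: "('p, 'w) kripke" assume M: "valued_model n M"
    have "Val M (Box (Var p \<^bold>\<rightarrow> Var q)) w \<le> Val M (Box (Var p) \<^bold>\<rightarrow> Box (Var q)) w" if w: "w \<in> worlds M" for w
    proof (cases "Val M (Box (Var q)) w = 1")
      case True
      then have "Val M (Box (Var p) \<^bold>\<rightarrow> Box (Var q)) w = 1"
        unfolding Val_Imp_1 using Val_unit[OF n M w, of "Box (Var p)"] by linarith
      then show ?thesis using Val_unit[OF n M w, of "Box (Var p \<^bold>\<rightarrow> Var q)"] by linarith
    next
      case False
      then obtain w' where r: "(w, w') \<in> rel M" "Val M (Box (Var q)) w = Val M (Var q) w'"
        using Val_Box_attained[OF n M] by blast
      have "Val M (Box (Var p \<^bold>\<rightarrow> Var q)) w \<le> Val M (Var p \<^bold>\<rightarrow> Var q) w'" by (rule Val_Box_le[OF n M r(1)])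
      also have "\<dots> = min (Val M (Var q) w' + (1 - Val M (Var p) w')) 1" by simp
      also have "\<dots> \<le> min (Val M (Box (Var q)) w + (1 - Val M (Box (Var p)) w)) 1"
        using Val_Box_le[OF n M r(1), of "Var p"] r(2) by linarith
      also have "\<dots> = Val M (Box (Var p) \<^bold>\<rightarrow> Box (Var q)) w" by simp
      finally show ?thesis .
    qed
    then show "true_in M (Box (Var p \<^bold>\<rightarrow> Var q) \<^bold>\<rightarrow> (Box (Var p) \<^bold>\<rightarrow> Box (Var q)))"
      unfolding true_in_def Val_Imp_1 by blast
  qed
  moreover have "Box (Var p \<oplus> Var p) \<^bold>\<leftrightarrow> (Box (Var p) \<oplus> Box (Var p)) \<in> ?L" for p
    by (rule box_fun[where f = "\<lambda>x. min (x + x) 1" and p = p]) (auto intro!: monoI)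
  moreover have "Box (Var p \<odot> Var p) \<^bold>\<leftrightarrow> (Box (Var p) \<odot> Box (Var p)) \<in> ?L" for p
    by (rule box_fun[where f = "\<lambda>x. 1 - min ((1 - x) + (1 - x)) 1" and p = p]) (auto intro!: monoI)
  moreover have "Box (Var p \<oplus> fpow (Var p) m) \<^bold>\<leftrightarrow> (Box (Var p) \<oplus> fpow (Box (Var p)) m) \<in> ?L" for p m
  proof (rule box_fun[where f = "\<lambda>x. min (x + luk_pow m x) 1" and p = p])
    show "mono (\<lambda>x. min (x + luk_pow m x) 1)"
      using monoD[OF mono_luk_pow] by (intro monoI min.mono add_mono) auto
  qed (simp_all add: luk_pow_1 Val_fpow)
  ultimately show ?thesis
    by (simp only: modal_mv_logic_def simp_thms)
qed

lemma soundness: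
  fixes M :: "('p, 'w) kripke"
  assumes inf: "infinite (UNIV :: 'p set)" and n: "n \<ge> 1" and B: "axiomatic_base n B"
    and ded: "deducible (K_logic B) \<Gamma> \<phi>" and M: "valued_model n M" and \<Gamma>: "model_of M \<Gamma>"
  shows "true_in M \<phi>"
proof -
  let ?T = "{\<psi>. true_in M \<psi>}"
  let ?L = "{\<phi>. \<forall>M :: ('p, 'w) kripke. valued_model n M \<longrightarrow> true_in M \<phi>}"
  have "luk_logic n \<subseteq> ?L"
  proof (intro subsetI CollectI allI impI)
    fix \<psi> :: "'p form" and N :: "('p, 'w) kripke"
    assume "\<psi> \<in> luk_logic n" "valued_model n N"
    then show "true_in N \<psi>"
      by (simp add: true_in_def luk_logic_def Val_box_free valued_model_def)
  qed
  then have "K_logic B \<subseteq> ?L"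
    unfolding K_logic_eq[OF B] using modal_mv_logic_valid[OF n, where ?'p = 'p and ?'w = 'w]
    unfolding K_logic_def by blast
  then have "\<Gamma> \<union> K_logic B \<subseteq> ?T" using M \<Gamma> by (auto simp: model_of_def)
  moreover have "closed_nec ?T"
    unfolding closed_nec_def
  proof (intro allI impI CollectI)
    fix \<psi> assume "\<psi> \<in> ?T"
    then show "true_in M (Box \<psi>)"
      using Val_Box_attained[OF n M, of \<psi>] valued_modelD(2)[OF M]
      by (fastforce simp: true_in_def simp del: Val.simps)
  qed
  moreover have "closed_mp ?T"
    unfolding closed_mp_def
  proof (intro allI impI CollectI)
    fix \<psi> \<chi> assume "\<psi> \<in> ?T" "\<psi> \<^bold>\<rightarrow> \<chi> \<in> ?T"
    then have *: "Val M \<psi> w = 1" "Val M \<psi> w \<le> Val M \<chi> w" if "w \<in> worlds M" for w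
      using that unfolding mem_Collect_eq true_in_def Val_Imp_1 by blast+
    have "Val M \<chi> w = 1" if "w \<in> worlds M" for w
      using *[OF that] Val_unit[OF n M that, of \<chi>] by linarith
    then show "true_in M \<chi>" unfolding true_in_def by blast
  qed
  ultimately show ?thesis
    using ded unfolding deducible_iff_necessitation[OF inf B] by blast
qed

section \<open>Completeness theorem\<close>

theorem theorem6p1:
  fixes n :: nat and B \<Gamma> :: "'p form set" and \<phi> :: "'p form"
  assumes "infinite (UNIV :: 'p set)"
    and "n \<ge> 1"
    and "axiomatic_base n B"
  shows "(deducible (K_logic B) \<Gamma> \<phi> \<longleftrightarrow>
            (\<forall>M :: ('p, 'p form \<Rightarrow> real) kripke.
               valued_model n M \<longrightarrow> model_of M \<Gamma> \<longrightarrow> true_in M \<phi>))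
       \<and> (deducible (K_logic B) \<Gamma> \<phi> \<longrightarrow>
            (\<forall>M :: ('p, 'w) kripke.
               valued_model n M \<longrightarrow> model_of M \<Gamma> \<longrightarrow> true_in M \<phi>))"
proof (intro conjI iffI allI impI)
  show "true_in M \<phi>" if "deducible (K_logic B) \<Gamma> \<phi>" "valued_model n M" "model_of M \<Gamma>"
    for M :: "('p, 'p form \<Rightarrow> real) kripke"
    using soundness[OF assms that] .
  show "true_in M \<phi>" if "deducible (K_logic B) \<Gamma> \<phi>" "valued_model n M" "model_of M \<Gamma>"
    for M :: "('p, 'w) kripke"
    using soundness[OF assms that] .
  show "deducible (K_logic B) \<Gamma> \<phi>"
    if "\<forall>M :: ('p, 'p form \<Rightarrow> real) kripke.
      valued_model n M \<longrightarrow> model_of M \<Gamma> \<longrightarrow> true_in M \<phi>"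
    using completeness[OF assms] that by blast
qed

end
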